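(* Let $C$ be a cycle, $\mathcal H$ a family of vertex subsets of $C$ such that $(C,\mathcal H)$ is $abab$-free, and $c:V(C)\to\{\mathbf r,\mathbf b\}$ a 2-colouring. Then there is an outerplanar graph $Q$ with vertex set $\mathbf b(V(C))=c^{-1}(\mathbf b)$ such that $Q[H\cap\mathbf b(V(C))]$ is connected for every $H\in\mathcal H$.
   Context: Let $C$ be a cycle with a fixed cyclic orientation; "vertices $p_1,\dots,p_4$ in cyclic order" means four distinct vertices met in this order when traversing $C$. A pair $H,H'\in\mathcal H$ is an $abab$-pair if there are vertices $a_1,b_1,a_2,b_2$ in cyclic order with $a_1,a_2\in H\setminus H'$ and $b_1,b_2\in H'\setminus H$; $(C,\mathcal H)$ is $abab$-free if there is no $abab$-pair. The 2-colouring need not be proper. A graph is outerplanar if it has a plane embedding with all vertices on the outer face. *)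

theory Defs
  imports "HOL-Analysis.Analysis"
begin

datatype colour = Red | Blue

text \<open>A cycle C with a fixed cyclic orientation is given by a duplicate-free list cs of
  its vertices (length at least 3), listed in the order of traversal; consecutive
  entries (and the last and first entry) are adjacent.\<close>

definition is_cycle_list :: "'a list \<Rightarrow> bool" where
  "is_cycle_list cs \<longleftrightarrow> distinct cs \<and> length cs \<ge> 3"

text \<open>Four distinct vertices p1,p2,p3,p4 met in this order when traversing the cycle.\<close>
definition in_cyclic_order :: "'a list \<Rightarrow> 'a \<Rightarrow> 'a \<Rightarrow> 'a \<Rightarrow> 'a \<Rightarrow> bool" where
  "in_cyclic_order cs p1 p2 p3 p4 \<longleftrightarrow>
     (\<exists>i1 i2 i3 i4. i1 < length cs \<and> i2 < length cs \<and> i3 < length cs \<and> i4 < length cs \<and>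
        cs ! i1 = p1 \<and> cs ! i2 = p2 \<and> cs ! i3 = p3 \<and> cs ! i4 = p4 \<and>
        ((i1 < i2 \<and> i2 < i3 \<and> i3 < i4) \<or> (i2 < i3 \<and> i3 < i4 \<and> i4 < i1) \<or>
         (i3 < i4 \<and> i4 < i1 \<and> i1 < i2) \<or> (i4 < i1 \<and> i1 < i2 \<and> i2 < i3)))"

definition abab_pair :: "'a list \<Rightarrow> 'a set \<Rightarrow> 'a set \<Rightarrow> bool" where
  "abab_pair cs H H' \<longleftrightarrow>
     (\<exists>a1 b1 a2 b2. in_cyclic_order cs a1 b1 a2 b2 \<and>
        a1 \<in> H - H' \<and> a2 \<in> H - H' \<and> b1 \<in> H' - H \<and> b2 \<in> H' - H)"

definition abab_free :: "'a list \<Rightarrow> 'a set set \<Rightarrow> bool" where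
  "abab_free cs \<H> \<longleftrightarrow> (\<forall>H\<in>\<H>. \<forall>H'\<in>\<H>. \<not> abab_pair cs H H')"

text \<open>Simple graphs: finite vertex set V, edges are 2-element subsets of V.\<close>
definition simple_graph :: "'a set \<Rightarrow> 'a set set \<Rightarrow> bool" where
  "simple_graph V E \<longleftrightarrow> finite V \<and> (\<forall>e\<in>E. \<exists>u v. e = {u, v} \<and> u \<noteq> v \<and> u \<in> V \<and> v \<in> V)"

text \<open>Plane embedding: injective placement of vertices in the plane (complex numbers),
  each edge drawn as an arc between its endpoints that avoids other vertex points,
  and distinct edges meet only in common endpoints.\<close>
definition plane_embedding ::
  "'a set \<Rightarrow> 'a set set \<Rightarrow> ('a \<Rightarrow> complex) \<Rightarrow> ('a set \<Rightarrow> real \<Rightarrow> complex) \<Rightarrow> bool" where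
  "plane_embedding V E pos \<gamma> \<longleftrightarrow>
     inj_on pos V \<and>
     (\<forall>e\<in>E. arc (\<gamma> e) \<and>
        (\<exists>u v. e = {u, v} \<and> pathstart (\<gamma> e) = pos u \<and> pathfinish (\<gamma> e) = pos v) \<and>
        path_image (\<gamma> e) \<inter> pos ` V = pos ` e) \<and>
     (\<forall>e\<in>E. \<forall>e'\<in>E. e \<noteq> e' \<longrightarrow> path_image (\<gamma> e) \<inter> path_image (\<gamma> e') \<subseteq> pos ` (e \<inter> e'))"

definition drawing ::
  "'a set \<Rightarrow> 'a set set \<Rightarrow> ('a \<Rightarrow> complex) \<Rightarrow> ('a set \<Rightarrow> real \<Rightarrow> complex) \<Rightarrow> complex set" where
  "drawing V E pos \<gamma> = pos ` V \<union> (\<Union>e\<in>E. path_image (\<gamma> e))"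

text \<open>Outerplanar: has a plane embedding with all vertices on the outer (unbounded) face.\<close>
definition outerplanar :: "'a set \<Rightarrow> 'a set set \<Rightarrow> bool" where
  "outerplanar V E \<longleftrightarrow> simple_graph V E \<and>
     (\<exists>pos \<gamma>. plane_embedding V E pos \<gamma> \<and>
        (\<exists>F \<in> components (- drawing V E pos \<gamma>). \<not> bounded F \<and>
           (\<forall>v\<in>V. pos v \<in> closure F)))"

text \<open>The induced subgraph Q[S] is connected (the empty graph counts as connected).\<close>
definition induced_connected :: "'a set set \<Rightarrow> 'a set \<Rightarrow> bool" where
  "induced_connected E S \<longleftrightarrow>
     (\<forall>u\<in>S. \<forall>v\<in>S. (u, v) \<in> {(x, y). x \<in> S \<and> y \<in> S \<and> {x, y} \<in> E}\<^sup>*)"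

end

theory Submission
  imports Defs
begin

text \<open>
  Say that a set blocks a chord \<open>xy\<close> of the circle if it avoids \<open>x\<close> and \<open>y\<close> and has points
  strictly on both sides of the chord. An unblocked chord with points on both sides splits the
  problem into two smaller ones: the supports of the two parts share \<open>x\<close> and \<open>y\<close>, and a set
  that meets both parts contains one of them. If no set blocks any pair of points, then every
  set is a cyclic interval, and the cycle itself is a support.

  Otherwise an unblocked chord exists. Take a smallest set \<open>L\<close> that blocks some pair \<open>g, h\<close>, and
  suppose that every chord joining the two parts of \<open>L\<close> cut off by \<open>g\<close> and \<open>h\<close> is blocked. By minimality
  a blocker \<open>X\<close> is not contained in \<open>L\<close>, and by alternation-freeness \<open>X - L\<close> lies on one side of
  the chord, that of \<open>g\<close> or that of \<open>h\<close>. The chord closest to \<open>h\<close> has no blocker of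
  the first kind. Let \<open>ba\<close> be the chord closest to \<open>g\<close> without one, and \<open>Y\<close> a blocker of it.
  On the side of \<open>g\<close>, \<open>Y\<close> contains a point of \<open>L\<close>; moving an end of the chord
  to the nearest such point gives a chord with a blocker \<open>X\<close> of the first kind, and \<open>X\<close>, \<open>Y\<close>
  alternate.

  A graph without crossing chords is drawn with straight segments between points of a parabola;
  its unbounded face contains the complement of the convex hull.
\<close>

section \<open>Positions, sides of a chord and blockers\<close>

definition alternation_free :: "('a \<Rightarrow> nat) \<Rightarrow> 'a set \<Rightarrow> 'a set set \<Rightarrow> bool" where
  "alternation_free p V F \<longleftrightarrow> (\<forall>H\<in>F. \<forall>H'\<in>F. \<forall>a\<in>V. \<forall>b\<in>V. \<forall>c\<in>V. \<forall>d\<in>V.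
     p a < p b \<longrightarrow> p b < p c \<longrightarrow> p c < p d \<longrightarrow>
     a \<in> H - H' \<longrightarrow> b \<in> H' - H \<longrightarrow> c \<in> H - H' \<longrightarrow> d \<in> H' - H \<longrightarrow> False)"

text \<open>Strict inequalities keep the ends of a chord off both sides, so that both ends can
  belong to both parts when the chord splits the problem.\<close>

definition on_inner_side :: "('a \<Rightarrow> nat) \<Rightarrow> 'a \<Rightarrow> 'a \<Rightarrow> 'a \<Rightarrow> bool" where
  "on_inner_side p x y u \<longleftrightarrow> (p x < p u \<and> p u < p y) \<or> (p y < p u \<and> p u < p x)"

definition on_outer_side :: "('a \<Rightarrow> nat) \<Rightarrow> 'a \<Rightarrow> 'a \<Rightarrow> 'a \<Rightarrow> bool" where
  "on_outer_side p x y u \<longleftrightarrow> (p u < p x \<and> p u < p y) \<or> (p x < p u \<and> p y < p u)"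

definition separates :: "('a \<Rightarrow> nat) \<Rightarrow> 'a set \<Rightarrow> 'a \<Rightarrow> 'a \<Rightarrow> bool" where
  "separates p S x y \<longleftrightarrow> (\<exists>u\<in>S. on_inner_side p x y u) \<and> (\<exists>v\<in>S. on_outer_side p x y v)"

definition blocks :: "('a \<Rightarrow> nat) \<Rightarrow> 'a set \<Rightarrow> 'a set \<Rightarrow> 'a \<Rightarrow> 'a \<Rightarrow> bool" where
  "blocks p V X x y \<longleftrightarrow> x \<notin> X \<and> y \<notin> X \<and> separates p (X \<inter> V) x y"

text \<open>One pattern of inequalities covers every interleaving of ends, since the ends of an
  edge, and the two edges, may be exchanged.\<close>

definition noncrossing :: "('a \<Rightarrow> nat) \<Rightarrow> 'a set set \<Rightarrow> bool" where
  "noncrossing p E \<longleftrightarrow> (\<forall>x y u v. {x, y} \<in> E \<longrightarrow> {u, v} \<in> E \<longrightarrow>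
     \<not> (p x < p u \<and> p u < p y \<and> p y < p v))"

lemma on_inner_side_if_less: "p x < p y \<Longrightarrow> on_inner_side p x y u \<longleftrightarrow> p x < p u \<and> p u < p y"
  unfolding on_inner_side_def by auto

lemma on_outer_side_if_less: "p x < p y \<Longrightarrow> on_outer_side p x y u \<longleftrightarrow> p u < p x \<or> p y < p u"
  unfolding on_outer_side_def by auto

section \<open>Existence of an unblocked chord\<close>

lemma alternation_freeD:
  assumes "alternation_free p V F" "H \<in> F" "H' \<in> F"
    and "a \<in> V" "b \<in> V" "c \<in> V" "d \<in> V" "p a < p b" "p b < p c" "p c < p d"
    and "a \<in> H - H'" "b \<in> H' - H" "c \<in> H - H'" "d \<in> H' - H"
  shows False
  using assms unfolding alternation_free_def by blast

lemma alternation_free_subset: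
  "alternation_free p V F \<Longrightarrow> W \<subseteq> V \<Longrightarrow> alternation_free p W F"
  unfolding alternation_free_def by blast

text \<open>Here the point \<open>g\<close> is not mentioned: it precedes all points in the order of positions.\<close>
lemma unblocked_chord_linear:
  fixes p :: "'a \<Rightarrow> nat"
  assumes fin: "finite V" and inj: "inj_on p V" and af: "alternation_free p V F"
    and L: "L \<in> F" and h: "h \<in> V" "h \<notin> L"
    and b0: "b0 \<in> L \<inter> V" "p b0 < p h" and a0: "a0 \<in> L \<inter> V" "p h < p a0"
    and minimal: "\<And>X x y. X \<in> F \<Longrightarrow> x \<in> V \<Longrightarrow> y \<in> V \<Longrightarrow> blocks p V X x y \<Longrightarrow>
      card (L \<inter> V) \<le> card (X \<inter> V)"
  obtains x y where "x \<in> L \<inter> V" "y \<in> L \<inter> V" "p x < p h" "p h < p y"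
    "\<And>X. X \<in> F \<Longrightarrow> \<not> blocks p V X x y"
proof (rule ccontr)
  assume "\<not> thesis"
  with that have blocked: "\<exists>X\<in>F. blocks p V X b a"
    if "b \<in> L \<inter> V" "a \<in> L \<inter> V" "p b < p h" "p h < p a" for a b
    using that by blast
  define S where "S = {(b, a). b \<in> L \<inter> V \<and> a \<in> L \<inter> V \<and> p b < p h \<and> p h < p a}"
  \<comment> \<open>For a blocker of kind \<open>Out\<close>, the points off \<open>L\<close> exist
    and all lie on the side of \<open>g\<close>; for kind \<open>In\<close>, on the side of
    \<open>h\<close>.\<close>
  define Out where "Out b a X \<longleftrightarrow> X \<in> F \<and> b \<notin> X \<and> a \<notin> X \<and>
      (\<exists>x\<in>X \<inter> V. on_outer_side p b a x \<and> x \<notin> L) \<and> (\<exists>x\<in>X \<inter> V. on_inner_side p b a x) \<and>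
      (\<forall>x\<in>X \<inter> V. on_inner_side p b a x \<longrightarrow> x \<in> L)" for b a X
  define In where "In b a X \<longleftrightarrow> X \<in> F \<and> b \<notin> X \<and> a \<notin> X \<and>
      (\<exists>x\<in>X \<inter> V. on_inner_side p b a x \<and> x \<notin> L) \<and> (\<exists>x\<in>X \<inter> V. on_outer_side p b a x) \<and>
      (\<forall>x\<in>X \<inter> V. on_outer_side p b a x \<longrightarrow> x \<in> L)" for b a X
  have pne: "p u \<noteq> p v" if "u \<in> V" "v \<in> V" "u \<noteq> v" for u v
    using inj that by (meson inj_onD)
  have one_side: "\<exists>X. Out b a X \<or> In b a X" if "(b, a) \<in> S" for b a
  proof -
    have ba: "b \<in> L" "b \<in> V" "a \<in> L" "a \<in> V" "p b < p h" "p h < p a"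
      using that unfolding S_def by auto
    obtain X where X: "X \<in> F" "blocks p V X b a" using blocked ba by blast
    then have nX: "b \<notin> X" "a \<notin> X" by (auto simp: blocks_def)
    \<comment> \<open>A blocker inside \<open>L\<close> misses \<open>b\<close>, so it is smaller
      than \<open>L\<close> and contradicts \<open>minimal\<close>.\<close>
    have "\<not> X \<inter> V \<subseteq> L"
    proof
      assume "X \<inter> V \<subseteq> L"
      then have "X \<inter> V \<subset> L \<inter> V" using ba nX by blast
      then have "card (X \<inter> V) < card (L \<inter> V)" using fin by (simp add: psubset_card_mono)
      with minimal[OF X(1) _ _ X(2)] ba show False by simp
    qed
    then obtain w where w: "w \<in> X" "w \<in> V" "w \<notin> L" by blast
    have "p w \<noteq> p b" "p w \<noteq> p a" using pne w ba by metis+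
    then have wside: "on_inner_side p b a w \<or> on_outer_side p b a w"
      using ba by (auto simp: on_inner_side_def on_outer_side_def)
    \<comment> \<open>Points of \<open>X - L\<close> on both sides would alternate with
      \<open>a\<close> and \<open>b\<close>, which lie in \<open>L - X\<close>.\<close>
    have "u \<in> L \<or> v \<in> L" if "u \<in> X \<inter> V" "v \<in> X \<inter> V" "on_inner_side p b a u" "on_outer_side p b a v" for u v
    proof (rule ccontr)
      assume "\<not> (u \<in> L \<or> v \<in> L)"
      moreover have "p b < p u" "p u < p a" "p v < p b \<or> p a < p v"
        using that ba by (auto simp: on_inner_side_def on_outer_side_def)
      ultimately show False
        using alternation_freeD[OF af X(1) L, of v b u a] alternation_freeD[OF af L X(1), of b u a v]
          that ba nX by blast
    qed
    with X nX w wside show ?thesis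
      unfolding Out_def In_def blocks_def separates_def by blast
  qed
  \<comment> \<open>\<open>b1\<close> and \<open>a1\<close> are the points of \<open>L\<close> next
    to \<open>h\<close>. No point of \<open>L\<close> lies strictly between them, whereas an
    \<open>Out\<close> blocker has inner points and these are all in \<open>L\<close>.\<close>
  obtain b1 where b1: "b1 \<in> L \<inter> V" "p b1 < p h"
    "\<And>y. y \<in> L \<inter> V \<Longrightarrow> p y < p h \<Longrightarrow> p y \<le> p b1"
    using ex_has_greatest_nat[of "\<lambda>b. b \<in> L \<inter> V \<and> p b < p h" b0 p "p h"] b0 by force
  obtain a1 where a1: "a1 \<in> L \<inter> V" "p h < p a1"
    "\<And>y. y \<in> L \<inter> V \<Longrightarrow> p h < p y \<Longrightarrow> p a1 \<le> p y"
    using ex_has_least_nat[of "\<lambda>a. a \<in> L \<inter> V \<and> p h < p a" a0 p] a0 by blast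
  have "\<not> Out b1 a1 X" for X
  proof
    assume "Out b1 a1 X"
    then obtain x where x: "x \<in> L" "x \<in> V" "on_inner_side p b1 a1 x" unfolding Out_def by blast
    then have "p x \<noteq> p h" using pne h by metis
    with x b1 a1 show False unfolding on_inner_side_def by (metis IntI linorder_not_less nat_neq_iff order_less_trans)
  qed
  then have "(b1, a1) \<in> S \<and> (\<forall>X. \<not> Out b1 a1 X)" using a1 b1 unfolding S_def by auto
  \<comment> \<open>Moving either end outwards within \<open>L\<close> decreases this measure, so
    the new chord must have an \<open>Out\<close> blocker. Subtracting from the maximal position
    keeps the truncated difference exact.\<close>
  then obtain b a where ba: "(b, a) \<in> S" and noOut: "\<And>X. \<not> Out b a X"
    and least: "\<And>b' a'. (b', a') \<in> S \<Longrightarrow> (\<forall>X. \<not> Out b' a' X) \<Longrightarrow>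
       p b + (Max (p ` V) - p a) \<le> p b' + (Max (p ` V) - p a')"
    using ex_has_least_nat[of "\<lambda>(b, a). (b, a) \<in> S \<and> (\<forall>X. \<not> Out b a X)" "(b1, a1)"
        "\<lambda>(b, a). p b + (Max (p ` V) - p a)"] by auto
  have pmax: "p v \<le> Max (p ` V)" if "v \<in> V" for v using that fin by simp
  have ba': "b \<in> L" "b \<in> V" "a \<in> L" "a \<in> V" "p b < p h" "p h < p a"
    using ba unfolding S_def by auto
  have pba: "p b < p a" using ba' by simp
  obtain Y where "In b a Y" using one_side[OF ba] noOut by blast
  then obtain y0 y1 where Y: "Y \<in> F" "b \<notin> Y" "a \<notin> Y" "y0 \<in> Y" "y0 \<in> V" "y0 \<notin> L"
      "p b < p y0" "p y0 < p a" "y1 \<in> Y" "y1 \<in> V" "p y1 < p b \<or> p a < p y1"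
    and Yout: "\<And>y. y \<in> Y \<Longrightarrow> y \<in> V \<Longrightarrow> p y < p b \<or> p a < p y \<Longrightarrow> y \<in> L"
    unfolding In_def on_inner_side_if_less[of p, OF pba]
      on_outer_side_if_less[of p, OF pba] by blast
  show False
  proof (cases "p y1 < p b")
    case True
    \<comment> \<open>The end \<open>b\<close> moves to the nearest point \<open>l\<close> of
      \<open>Y\<close> before it. As an outer point of \<open>Y\<close>, \<open>l\<close> is in
      \<open>L\<close>, so the choice of \<open>(b, a)\<close> yields an \<open>Out\<close> blocker
      \<open>X\<close> of \<open>(l, a)\<close>.\<close>
    obtain l where l: "l \<in> Y" "l \<in> V" "p l < p b"
      and lmax: "\<And>y. y \<in> Y \<Longrightarrow> y \<in> V \<Longrightarrow> p y < p b \<Longrightarrow> p y \<le> p l"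
      using ex_has_greatest_nat[of "\<lambda>y. y \<in> Y \<and> y \<in> V \<and> p y < p b" y1 p "p b"] True Y by force
    have "(l, a) \<in> S" using l Yout ba' unfolding S_def by auto
    then obtain X where "Out l a X" using least[of l a] l by fastforce
    have la: "p l < p a" using l ba' by simp
    from \<open>Out l a X\<close>
    obtain x0 w where X: "X \<in> F" "l \<notin> X" "a \<notin> X" "x0 \<in> X" "x0 \<in> V" "x0 \<notin> L"
        "p x0 < p l \<or> p a < p x0" "w \<in> X" "w \<in> V" "p l < p w" "p w < p a"
      and Xin: "\<And>x. x \<in> X \<Longrightarrow> x \<in> V \<Longrightarrow> p l < p x \<Longrightarrow> p x < p a \<Longrightarrow> x \<in> L"
      unfolding Out_def on_inner_side_if_less[of p, OF la] on_outer_side_if_less[of p, OF la] by blast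
    have x0Y: "x0 \<notin> Y" using Yout X l by fastforce
    have y0X: "y0 \<notin> X" using Xin Y l by fastforce
    \<comment> \<open>Otherwise \<open>l\<close>, \<open>x\<close>, \<open>y0\<close> and the point
      \<open>x0\<close>, which comes before or after all three, alternate between
      \<open>Y - X\<close> and \<open>X - Y\<close>.\<close>
    have *: "x \<in> Y" if "x \<in> X" "x \<in> V" "p l < p x" "p x < p y0" for x
    proof (rule ccontr)
      assume "x \<notin> Y"
      then have mem: "x0 \<in> X - Y" "l \<in> Y - X" "x \<in> X - Y" "y0 \<in> Y - X"
        using X Y l that x0Y y0X by auto
      have "p y0 < p x0" if "p a < p x0" using that Y by simp
      then show False
        using alternation_freeD[OF af X(1) Y(1) X(5) l(2) that(2) Y(5)]
          alternation_freeD[OF af Y(1) X(1) l(2) that(2) Y(5) X(5)] mem that X(7) by blast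
    qed
    have "b \<notin> X" using * ba' l Y by blast
    \<comment> \<open>If \<open>w\<close> lay after \<open>b\<close>, then \<open>X\<close> would be
      an \<open>Out\<close> blocker of \<open>(b, a)\<close> itself. Hence \<open>w\<close> is
      between \<open>l\<close> and \<open>b\<close>, so it is in \<open>Y\<close> by
      \<open>*\<close>, against the choice of \<open>l\<close>.\<close>
    have "\<not> (p b < p w)"
    proof
      assume "p b < p w"
      then have "Out b a X"
        unfolding Out_def on_inner_side_if_less[of p, OF pba] on_outer_side_if_less[of p, OF pba]
        using X \<open>b \<notin> X\<close> Xin l by (meson IntD1 IntD2 IntI less_trans)
      with noOut show False by blast
    qed
    moreover have "p w \<noteq> p b" using pne X ba' \<open>b \<notin> X\<close> by metis
    ultimately have "p w < p b" by simp
    then show False using * lmax X Y by fastforce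
  next
    case False
    \<comment> \<open>The mirror image: the end \<open>a\<close> moves to the nearest point of
      \<open>Y\<close> after it.\<close>
    then obtain l where l: "l \<in> Y" "l \<in> V" "p a < p l"
      and lmin: "\<And>y. y \<in> Y \<Longrightarrow> y \<in> V \<Longrightarrow> p a < p y \<Longrightarrow> p l \<le> p y"
      using ex_has_least_nat[of "\<lambda>y. y \<in> Y \<and> y \<in> V \<and> p a < p y" y1 p] Y by blast
    have "(b, l) \<in> S" using l Yout ba' unfolding S_def by auto
    then obtain X where "Out b l X" using least[of b l] l pmax[of l] by fastforce
    have bl: "p b < p l" using l ba' by simp
    from \<open>Out b l X\<close>
    obtain x0 w where X: "X \<in> F" "l \<notin> X" "b \<notin> X" "x0 \<in> X" "x0 \<in> V" "x0 \<notin> L"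
        "p x0 < p b \<or> p l < p x0" "w \<in> X" "w \<in> V" "p b < p w" "p w < p l"
      and Xin: "\<And>x. x \<in> X \<Longrightarrow> x \<in> V \<Longrightarrow> p b < p x \<Longrightarrow> p x < p l \<Longrightarrow> x \<in> L"
      unfolding Out_def on_inner_side_if_less[of p, OF bl] on_outer_side_if_less[of p, OF bl] by blast
    have x0Y: "x0 \<notin> Y" using Yout X l by fastforce
    have y0X: "y0 \<notin> X" using Xin Y l by fastforce
    have *: "x \<in> Y" if "x \<in> X" "x \<in> V" "p y0 < p x" "p x < p l" for x
    proof (rule ccontr)
      assume "x \<notin> Y"
      then have mem: "x0 \<in> X - Y" "l \<in> Y - X" "x \<in> X - Y" "y0 \<in> Y - X"
        using X Y l that x0Y y0X by auto
      have "p x0 < p y0" if "p x0 < p b" using that Y by simp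
      then show False
        using alternation_freeD[OF af X(1) Y(1) X(5) Y(5) that(2) l(2)]
          alternation_freeD[OF af Y(1) X(1) Y(5) that(2) l(2) X(5)] mem that X(7) by blast
    qed
    have "a \<notin> X" using * ba' l Y by blast
    have "\<not> (p w < p a)"
    proof
      assume "p w < p a"
      then have "Out b a X"
        unfolding Out_def on_inner_side_if_less[of p, OF pba] on_outer_side_if_less[of p, OF pba]
        using X \<open>a \<notin> X\<close> Xin l by (meson IntD1 IntD2 IntI less_trans)
      with noOut show False by blast
    qed
    moreover have "p w \<noteq> p a" using pne X ba' \<open>a \<notin> X\<close> by metis
    ultimately have "p a < p w" by simp
    then show False using * lmin X Y by fastforce
  qed
qed

text \<open>The cyclic order read from \<open>g\<close>; meaningful only if \<open>N\<close> exceeds all positions.\<close>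
definition rotate_pos :: "('a \<Rightarrow> nat) \<Rightarrow> nat \<Rightarrow> 'a \<Rightarrow> 'a \<Rightarrow> nat" where
  "rotate_pos p N g x = (if p x < p g then p x + N else p x)"

lemma inj_on_rotate_pos:
  assumes "inj_on p V" "\<And>x. x \<in> V \<Longrightarrow> p x < N"
  shows "inj_on (rotate_pos p N g) V"
proof (rule inj_onI)
  fix x y assume "x \<in> V" "y \<in> V" "rotate_pos p N g x = rotate_pos p N g y"
  then have "p x = p y"
    using assms(2)[of x] assms(2)[of y] unfolding rotate_pos_def by (auto split: if_splits)
  then show "x = y" using assms(1) \<open>x \<in> V\<close> \<open>y \<in> V\<close> by (meson inj_onD)
qed

text \<open>Rotation shifts an alternating quadruple cyclically. A shift by an odd number of places
  exchanges \<open>H\<close> and \<open>H'\<close>, which the quantification over ordered pairs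
  allows.\<close>

lemma alternation_free_rotate_pos:
  assumes af: "alternation_free p V F" and N: "\<And>x. x \<in> V \<Longrightarrow> p x < N"
  shows "alternation_free (rotate_pos p N g) V F"
  unfolding alternation_free_def
proof (intro ballI impI)
  fix H H' a b c d
  let ?q = "rotate_pos p N g"
  assume *: "H \<in> F" "H' \<in> F" "a \<in> V" "b \<in> V" "c \<in> V" "d \<in> V"
    "a \<in> H - H'" "b \<in> H' - H" "c \<in> H - H'" "d \<in> H' - H"
    and q: "?q a < ?q b" "?q b < ?q c" "?q c < ?q d"
  have "(p a < p b \<and> p b < p c \<and> p c < p d) \<or> (p d < p a \<and> p a < p b \<and> p b < p c) \<or>
     (p c < p d \<and> p d < p a \<and> p a < p b) \<or> (p b < p c \<and> p c < p d \<and> p d < p a)"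
    using q N[OF *(3)] N[OF *(4)] N[OF *(5)] N[OF *(6)]
    unfolding rotate_pos_def by (auto split: if_splits)
  then show False
    using alternation_freeD[OF af *(1,2), of a b c d] alternation_freeD[OF af *(2,1), of d a b c]
      alternation_freeD[OF af *(1,2), of c d a b] alternation_freeD[OF af *(2,1), of b c d a] *
    by blast
qed

text \<open>A rotation swaps the two sides of the chord when exactly one end precedes
  \<open>g\<close>, and keeps them otherwise; \<open>separates\<close> treats both sides
  alike.\<close>

lemma separates_rotate_pos:
  assumes N: "\<And>x. x \<in> V \<Longrightarrow> p x < N" and "S \<subseteq> V" "x \<in> V" "y \<in> V"
  shows "separates (rotate_pos p N g) S x y \<longleftrightarrow> separates p S x y"
proof -
  let ?q = "rotate_pos p N g"
  have "(\<forall>u\<in>S. (on_inner_side ?q x y u \<longleftrightarrow> on_inner_side p x y u) \<and> (on_outer_side ?q x y u \<longleftrightarrow> on_outer_side p x y u)) \<or>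
    (\<forall>u\<in>S. (on_inner_side ?q x y u \<longleftrightarrow> on_outer_side p x y u) \<and> (on_outer_side ?q x y u \<longleftrightarrow> on_inner_side p x y u))"
  proof (cases "p x < p g \<longleftrightarrow> p y < p g")
    case True
    have "\<forall>u\<in>S. (on_inner_side ?q x y u \<longleftrightarrow> on_inner_side p x y u) \<and> (on_outer_side ?q x y u \<longleftrightarrow> on_outer_side p x y u)"
    proof
      fix u assume "u \<in> S"
      then have "p u < N" "p x < N" "p y < N" using assms by auto
      with True show "(on_inner_side ?q x y u \<longleftrightarrow> on_inner_side p x y u) \<and> (on_outer_side ?q x y u \<longleftrightarrow> on_outer_side p x y u)"
        unfolding on_inner_side_def on_outer_side_def rotate_pos_def by auto
    qed
    then show ?thesis ..
  next
    case False
    have "\<forall>u\<in>S. (on_inner_side ?q x y u \<longleftrightarrow> on_outer_side p x y u) \<and> (on_outer_side ?q x y u \<longleftrightarrow> on_inner_side p x y u)"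
    proof
      fix u assume "u \<in> S"
      then have "p u < N" "p x < N" "p y < N" using assms by auto
      with False show "(on_inner_side ?q x y u \<longleftrightarrow> on_outer_side p x y u) \<and> (on_outer_side ?q x y u \<longleftrightarrow> on_inner_side p x y u)"
        unfolding on_inner_side_def on_outer_side_def rotate_pos_def by auto
    qed
    then show ?thesis ..
  qed
  then show ?thesis unfolding separates_def by blast
qed

lemma blocks_rotate_pos:
  assumes "\<And>x. x \<in> V \<Longrightarrow> p x < N" "x \<in> V" "y \<in> V"
  shows "blocks (rotate_pos p N g) V X x y \<longleftrightarrow> blocks p V X x y"
  unfolding blocks_def using separates_rotate_pos[of V p N "X \<inter> V" x y g] assms by simp

lemma unblocked_chord:
  assumes fin: "finite V" and inj: "inj_on p V" and af: "alternation_free p V F"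
    and H: "H \<in> F" "g \<in> V" "h \<in> V" "blocks p V H g h"
  obtains x y where "x \<in> V" "y \<in> V" "separates p V x y" "\<And>X. X \<in> F \<Longrightarrow> \<not> blocks p V X x y"
proof -
  obtain L where "L \<in> F \<and> (\<exists>g\<in>V. \<exists>h\<in>V. blocks p V L g h)"
    and minimal: "\<And>X. X \<in> F \<and> (\<exists>g\<in>V. \<exists>h\<in>V. blocks p V X g h) \<Longrightarrow> card (L \<inter> V) \<le> card (X \<inter> V)"
    using ex_has_least_nat[of "\<lambda>L. L \<in> F \<and> (\<exists>g\<in>V. \<exists>h\<in>V. blocks p V L g h)" H "\<lambda>L. card (L \<inter> V)"] H
    by blast
  then obtain g h where L: "L \<in> F" and gh: "g \<in> V" "h \<in> V" "blocks p V L g h" by blast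
  define N where "N = Suc (Max (p ` V))"
  have N: "p x < N" if "x \<in> V" for x using that fin unfolding N_def by (simp add: le_imp_less_Suc)
  define q where "q = rotate_pos p N g"
  have q0: "q g \<le> q v" if "v \<in> V" for v
    using N[OF gh(1)] unfolding q_def rotate_pos_def by auto
  have "blocks q V L g h" using gh blocks_rotate_pos[of V p N g h g L, OF N] unfolding q_def by simp
  then obtain b0 a0 where b0: "b0 \<in> L \<inter> V" "on_inner_side q g h b0" and a0: "a0 \<in> L \<inter> V" "on_outer_side q g h a0"
    and "h \<notin> L" unfolding blocks_def separates_def by blast
  \<comment> \<open>As \<open>g\<close> comes first in the order \<open>q\<close>, the inner side of
    \<open>gh\<close> lies before \<open>h\<close> and the outer side after
    \<open>h\<close>.\<close>
  have pos: "q b0 < q h" "q h < q a0"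
    using b0 a0 q0[of h] q0[of a0] q0[of b0] gh unfolding on_inner_side_def on_outer_side_def by auto
  have qinj: "inj_on q V" unfolding q_def using inj N by (rule inj_on_rotate_pos)
  have qaf: "alternation_free q V F" unfolding q_def using af N by (rule alternation_free_rotate_pos)
  have qmin: "card (L \<inter> V) \<le> card (X \<inter> V)"
    if "X \<in> F" "x \<in> V" "y \<in> V" "blocks q V X x y" for X x y
    using that minimal[of X] blocks_rotate_pos[of V p N x y g X, OF N] unfolding q_def by auto
  obtain x y where xy: "x \<in> L \<inter> V" "y \<in> L \<inter> V" "q x < q h" "q h < q y"
    "\<And>X. X \<in> F \<Longrightarrow> \<not> blocks q V X x y"
    by (rule unblocked_chord_linear[OF fin qinj qaf L gh(2) \<open>h \<notin> L\<close> b0(1) pos(1) a0(1) pos(2)])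
      (use qmin in blast)+
  \<comment> \<open>The points \<open>h\<close> and \<open>g\<close> themselves witness the two
    sides of \<open>xy\<close>.\<close>
  have "g \<noteq> x" using xy gh unfolding blocks_def by blast
  then have "q g \<noteq> q x" using xy gh qinj by (meson IntE inj_onD)
  then have "q g < q x" using q0[of x] xy by auto
  then have "separates q V x y" unfolding separates_def on_inner_side_def on_outer_side_def
    using xy gh by (meson order_less_trans)
  then have "separates p V x y"
    using separates_rotate_pos[of V p N V x y g, OF N] xy unfolding q_def by simp
  then show thesis
    using that[of x y] xy blocks_rotate_pos[of V p N x y g, OF N] unfolding q_def by simp
qed

section \<open>The case without blockers: the cycle as a support\<close>

lemma induced_path_mono:
  assumes "(u, v) \<in> {(x, y). x \<in> S \<and> y \<in> S \<and> {x, y} \<in> E}\<^sup>*" "S \<subseteq> T" "E \<subseteq> E'"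
  shows "(u, v) \<in> {(x, y). x \<in> T \<and> y \<in> T \<and> {x, y} \<in> E'}\<^sup>*"
  by (rule rtrancl_mono[THEN subsetD, OF _ assms(1)]) (use assms in auto)

lemma induced_path_sym:
  assumes "(u, v) \<in> {(x, y). x \<in> S \<and> y \<in> S \<and> {x, y} \<in> E}\<^sup>*"
  shows "(v, u) \<in> {(x, y). x \<in> S \<and> y \<in> S \<and> {x, y} \<in> E}\<^sup>*"
proof -
  have "sym {(x, y). x \<in> S \<and> y \<in> S \<and> {x, y} \<in> E}" by (auto intro: symI simp: insert_commute)
  then show ?thesis using assms by (meson sym_rtrancl symD)
qed

text \<open>For injective \<open>p\<close> this is the cycle through \<open>V\<close>: one side of a
  chord is empty exactly when its ends are neighbours in the cyclic order of \<open>V\<close>, first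
  and last point included.\<close>

definition cycle_edges :: "('a \<Rightarrow> nat) \<Rightarrow> 'a set \<Rightarrow> 'a set set" where
  "cycle_edges p V = {{x, y} |x y. x \<in> V \<and> y \<in> V \<and> x \<noteq> y \<and> \<not> separates p V x y}"

lemma cycle_edgesI:
  "x \<in> V \<Longrightarrow> y \<in> V \<Longrightarrow> x \<noteq> y \<Longrightarrow> \<not> separates p V x y \<Longrightarrow> {x, y} \<in> cycle_edges p V"
  unfolding cycle_edges_def by blast

text \<open>A chord crossing \<open>xy\<close> has an end on each side of \<open>xy\<close>, so
  neither side is empty.\<close>

lemma noncrossing_cycle_edges: "noncrossing p (cycle_edges p V)"
  unfolding noncrossing_def
proof (intro allI impI notI)
  fix x y u v
  assume E: "{x, y} \<in> cycle_edges p V" "{u, v} \<in> cycle_edges p V"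
    and ord: "p x < p u \<and> p u < p y \<and> p y < p v"
  have "u \<in> V" "v \<in> V" using E(2) unfolding cycle_edges_def by (auto simp: doubleton_eq_iff)
  then have "separates p V x y" "separates p V y x"
    using ord unfolding separates_def on_inner_side_def on_outer_side_def by (meson order_less_trans)+
  then show False using E(1) unfolding cycle_edges_def by (auto simp: doubleton_eq_iff)
qed

lemma cycle_edges_walk:
  assumes inj: "inj_on p V" and S: "S \<subseteq> V"
    and "u \<in> S" "v \<in> S" "p u \<le> p v" "\<And>w. w \<in> V \<Longrightarrow> p u \<le> p w \<Longrightarrow> p w \<le> p v \<Longrightarrow> w \<in> S"
  shows "(u, v) \<in> {(x, y). x \<in> S \<and> y \<in> S \<and> {x, y} \<in> cycle_edges p V}\<^sup>*"
  using assms(3-)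
proof (induction "p v - p u" arbitrary: u rule: less_induct)
  case less
  show ?case
  proof (cases "u = v")
    case False
    then have "p u < p v" using less.prems inj S by (metis inj_onD le_neq_implies_less subsetD)
    \<comment> \<open>\<open>w\<close> is the successor of \<open>u\<close> in
      \<open>V\<close>.\<close>
    then obtain w where w: "w \<in> V" "p u < p w" and wmin: "\<And>y. y \<in> V \<Longrightarrow> p u < p y \<Longrightarrow> p w \<le> p y"
      using ex_has_least_nat[of "\<lambda>w. w \<in> V \<and> p u < p w" v p] less.prems S by blast
    have wv: "p w \<le> p v" using wmin less.prems S \<open>p u < p v\<close> by blast
    have wS: "w \<in> S" using less.prems(4) w wv by simp
    have "\<not> separates p V u w" unfolding separates_def on_inner_side_def using wmin w by fastforce
    then have "{u, w} \<in> cycle_edges p V" using cycle_edgesI[of u V w p] w S less.prems by auto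
    moreover have "(w, v) \<in> {(x, y). x \<in> S \<and> y \<in> S \<and> {x, y} \<in> cycle_edges p V}\<^sup>*"
      using less.hyps[of w] w wv wS less.prems by auto
    ultimately show ?thesis using wS less.prems by (simp add: converse_rtrancl_into_rtrancl)
  qed simp
qed

lemma cycle_edges_connected:
  assumes fin: "finite V" and inj: "inj_on p V"
    and nb: "\<And>x y. x \<in> V \<Longrightarrow> y \<in> V \<Longrightarrow> \<not> blocks p V H x y"
  shows "induced_connected (cycle_edges p V) (H \<inter> V)"
proof -
  let ?R = "{(x, y). x \<in> H \<inter> V \<and> y \<in> H \<inter> V \<and> {x, y} \<in> cycle_edges p V}"
  have *: "(u, v) \<in> ?R\<^sup>*" if uv: "u \<in> H \<inter> V" "v \<in> H \<inter> V" "p u \<le> p v" for u v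
  proof (cases "\<forall>w\<in>V. p u \<le> p w \<longrightarrow> p w \<le> p v \<longrightarrow> w \<in> H")
    case True
    then show ?thesis using cycle_edges_walk[OF inj, of "H \<inter> V" u v] uv by blast
  next
    case False
    then obtain g where g: "g \<in> V" "p u \<le> p g" "p g \<le> p v" "g \<notin> H" by blast
    then have "p g \<noteq> p u" "p g \<noteq> p v" using inj uv by (metis IntE inj_onD)+
    with g have g': "p u < p g" "p g < p v" by auto
    \<comment> \<open>Were \<open>w\<close> missing from \<open>H\<close>, then \<open>H\<close>
      would block \<open>gw\<close>, with \<open>u\<close> and \<open>v\<close> on different sides.
      So \<open>H\<close> contains the whole arc from \<open>v\<close> round to
      \<open>u\<close>.\<close>
    have out: "w \<in> H" if w: "w \<in> V" "p w \<le> p u \<or> p v \<le> p w" for w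
    proof (rule ccontr)
      assume "w \<notin> H"
      then have "p w \<noteq> p u" "p w \<noteq> p v" using inj uv w by (metis IntE inj_onD)+
      then have "blocks p V H g w" unfolding blocks_def separates_def on_inner_side_def on_outer_side_def
        using g g' \<open>w \<notin> H\<close> uv w by (metis nat_less_le order_less_trans)
      then show False using nb g w by blast
    qed
    \<comment> \<open>The path runs from \<open>u\<close> down to the first point \<open>m\<close>,
      along the closing edge to the last point \<open>M\<close>, and down to
      \<open>v\<close>.\<close>
    obtain m where m: "m \<in> V" "\<And>y. y \<in> V \<Longrightarrow> p m \<le> p y"
      using ex_has_least_nat[of "\<lambda>w. w \<in> V" u p] uv by blast
    obtain M where M: "M \<in> V" "\<And>y. y \<in> V \<Longrightarrow> p y \<le> p M"
      using ex_has_greatest_nat[of "\<lambda>w. w \<in> V" u p "Suc (Max (p ` V))"] uv fin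
      by (auto simp: le_imp_less_Suc)
    have HmM: "m \<in> H" "M \<in> H" using out[of m] out[of M] m M uv by auto
    have "(m, u) \<in> ?R\<^sup>*"
      using cycle_edges_walk[OF inj, of "H \<inter> V" m u] m HmM uv out by auto
    then have 1: "(u, m) \<in> ?R\<^sup>*" by (rule induced_path_sym)
    have "(v, M) \<in> ?R\<^sup>*"
      using cycle_edges_walk[OF inj, of "H \<inter> V" v M] M HmM uv out by auto
    then have 3: "(M, v) \<in> ?R\<^sup>*" by (rule induced_path_sym)
    have "\<not> separates p V m M" unfolding separates_def on_outer_side_def
      using m M by (meson linorder_not_less)
    moreover have "m \<noteq> M" using m(2)[of u] M(2)[of v] uv g' by force
    ultimately have "(m, M) \<in> ?R" using cycle_edgesI[of m V M p] m M HmM by blast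
    with 1 3 show ?thesis by (meson r_into_rtrancl rtrancl_trans)
  qed
  show ?thesis unfolding induced_connected_def
  proof (intro ballI)
    fix u v assume "u \<in> H \<inter> V" "v \<in> H \<inter> V"
    then show "(u, v) \<in> ?R\<^sup>*"
      using *[of u v] *[of v u, THEN induced_path_sym] nat_le_linear[of "p u" "p v"] by blast
  qed
qed

section \<open>Noncrossing supports, by splitting along an unblocked chord\<close>

lemma noncrossing_support:
  assumes "finite V" "inj_on p V" "alternation_free p V F"
  shows "\<exists>E. simple_graph V E \<and> noncrossing p E \<and> (\<forall>H\<in>F. induced_connected E (H \<inter> V))"
  using assms
proof (induction V rule: finite_psubset_induct)
  case (psubset V)
  show ?case
  proof (cases "\<exists>H\<in>F. \<exists>g\<in>V. \<exists>h\<in>V. blocks p V H g h")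
    case False
    have "simple_graph V (cycle_edges p V)"
      unfolding simple_graph_def cycle_edges_def using psubset.hyps by blast
    moreover have "\<forall>H\<in>F. induced_connected (cycle_edges p V) (H \<inter> V)"
      using cycle_edges_connected[OF psubset.hyps psubset.prems(1)] False by blast
    ultimately show ?thesis using noncrossing_cycle_edges by blast
  next
    case True
    then obtain x0 y0 where xy0: "x0 \<in> V" "y0 \<in> V" "separates p V x0 y0"
      "\<And>X. X \<in> F \<Longrightarrow> \<not> blocks p V X x0 y0"
      using unblocked_chord[OF psubset.hyps psubset.prems] by (metis (no_types))
    have "p x0 \<noteq> p y0" using xy0(3) unfolding separates_def on_inner_side_def by auto
    moreover have "separates p S x0 y0 \<longleftrightarrow> separates p S y0 x0" for S
      unfolding separates_def on_inner_side_def on_outer_side_def by blast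
    ultimately obtain x y where xy: "x \<in> V" "y \<in> V" "p x < p y" "separates p V x y"
      and nb: "\<And>X. X \<in> F \<Longrightarrow> \<not> blocks p V X x y"
      using xy0 unfolding blocks_def by (metis linorder_neqE_nat)
    \<comment> \<open>Both parts contain \<open>x\<close> and \<open>y\<close>; each is a proper
      subset because \<open>V\<close> has points strictly on both sides.\<close>
    define V1 where "V1 = {v \<in> V. p x \<le> p v \<and> p v \<le> p y}"
    define V2 where "V2 = {v \<in> V. p v \<le> p x \<or> p y \<le> p v}"
    have V12: "V1 \<union> V2 = V" unfolding V1_def V2_def by auto
    obtain u v where "u \<in> V" "p x < p u" "p u < p y" "v \<in> V" "p v < p x \<or> p y < p v"
      using xy unfolding separates_def
      by (auto simp: on_inner_side_if_less[of p, OF xy(3)] on_outer_side_if_less[of p, OF xy(3)])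
    then have "u \<in> V - V2" "v \<in> V - V1" unfolding V1_def V2_def by auto
    then have "V1 \<subset> V" "V2 \<subset> V" using V12 by blast+
    then have IH: "\<exists>E. simple_graph W E \<and> noncrossing p E \<and> (\<forall>H\<in>F. induced_connected E (H \<inter> W))"
      if "W = V1 \<or> W = V2" for W
      using psubset.IH[of W] psubset.prems that
      by (metis alternation_free_subset inj_on_subset psubset_imp_subset)
    obtain E1 where E1: "simple_graph V1 E1" "noncrossing p E1" "\<forall>H\<in>F. induced_connected E1 (H \<inter> V1)"
      using IH[of V1] by blast
    obtain E2 where E2: "simple_graph V2 E2" "noncrossing p E2" "\<forall>H\<in>F. induced_connected E2 (H \<inter> V2)"
      using IH[of V2] by blast
    have in1: "u \<in> V1 \<and> v \<in> V1" if "{u, v} \<in> E1" for u v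
      using E1(1) that unfolding simple_graph_def by (metis doubleton_eq_iff)
    have in2: "u \<in> V2 \<and> v \<in> V2" if "{u, v} \<in> E2" for u v
      using E2(1) that unfolding simple_graph_def by (metis doubleton_eq_iff)
    have "simple_graph V (E1 \<union> E2)"
      unfolding simple_graph_def
    proof (intro conjI ballI)
      fix e assume "e \<in> E1 \<union> E2"
      then obtain u v where "e = {u, v}" "u \<noteq> v" "u \<in> V1 \<and> v \<in> V1 \<or> u \<in> V2 \<and> v \<in> V2"
        using E1(1) E2(1) unfolding simple_graph_def by (metis UnE)
      then show "\<exists>u v. e = {u, v} \<and> u \<noteq> v \<and> u \<in> V \<and> v \<in> V" using V12 by blast
    qed (rule psubset.hyps)
    moreover have "noncrossing p (E1 \<union> E2)"
      unfolding noncrossing_def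
    proof (intro allI impI notI)
      fix a b c d
      assume e: "{a, b} \<in> E1 \<union> E2" "{c, d} \<in> E1 \<union> E2" and o: "p a < p c \<and> p c < p b \<and> p b < p d"
      have "\<not> ({a, b} \<in> E1 \<and> {c, d} \<in> E1)" using E1(2) o unfolding noncrossing_def by blast
      moreover have "\<not> ({a, b} \<in> E2 \<and> {c, d} \<in> E2)" using E2(2) o unfolding noncrossing_def by blast
      \<comment> \<open>A crossing of edges from different parts would put a point of
        \<open>V2\<close> strictly between \<open>x\<close> and \<open>y\<close>.\<close>
      moreover have "\<not> ({a, b} \<in> E1 \<and> {c, d} \<in> E2)"
        using in1[of a b] in2[of c d] o unfolding V1_def V2_def by auto
      moreover have "\<not> ({a, b} \<in> E2 \<and> {c, d} \<in> E1)"
        using in2[of a b] in1[of c d] o unfolding V1_def V2_def by auto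
      ultimately show False using e by blast
    qed
    moreover have "induced_connected (E1 \<union> E2) (H \<inter> V)" if H: "H \<in> F" for H
    proof -
      let ?R = "{(x, y). x \<in> H \<inter> V \<and> y \<in> H \<inter> V \<and> {x, y} \<in> E1 \<union> E2}"
      have c1: "(u, v) \<in> ?R\<^sup>*" if "u \<in> H \<inter> V1" "v \<in> H \<inter> V1" for u v
      proof (rule induced_path_mono)
        show "(u, v) \<in> {(x, y). x \<in> H \<inter> V1 \<and> y \<in> H \<inter> V1 \<and> {x, y} \<in> E1}\<^sup>*"
          using E1(3) H that unfolding induced_connected_def by blast
      qed (use V12 in auto)
      have c2: "(u, v) \<in> ?R\<^sup>*" if "u \<in> H \<inter> V2" "v \<in> H \<inter> V2" for u v
      proof (rule induced_path_mono)
        show "(u, v) \<in> {(x, y). x \<in> H \<inter> V2 \<and> y \<in> H \<inter> V2 \<and> {x, y} \<in> E2}\<^sup>*"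
          using E2(3) H that unfolding induced_connected_def by blast
      qed (use V12 in auto)
      have ends: "x \<in> V1" "x \<in> V2" "y \<in> V1" "y \<in> V2" using xy unfolding V1_def V2_def by auto
      have c12: "(u, v) \<in> ?R\<^sup>*" if "u \<in> H \<inter> V1" "v \<in> H \<inter> V2" for u v
      proof (cases "u \<in> V2 \<or> v \<in> V1")
        case True
        then show ?thesis using c1 c2 that by blast
      next
        case False
        then have "on_inner_side p x y u" "on_outer_side p x y v"
          using that xy unfolding V1_def V2_def on_inner_side_def on_outer_side_def by auto
        \<comment> \<open>\<open>H\<close> meets both sides of an unblocked chord, so it contains an
          end, where paths in the two parts can be joined.\<close>
        then have "x \<in> H \<or> y \<in> H"
          using nb[OF H] that V12 unfolding blocks_def separates_def by blast
        then show ?thesis using ends c1 c2 that by (meson IntI rtrancl_trans)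
      qed
      show ?thesis unfolding induced_connected_def
      proof (intro ballI)
        fix u v assume "u \<in> H \<inter> V" "v \<in> H \<inter> V"
        then show "(u, v) \<in> ?R\<^sup>*"
          using V12 c1 c2 c12[of u v] c12[of v u, THEN induced_path_sym] by blast
      qed
    qed
    ultimately show ?thesis by blast
  qed
qed

section \<open>Straight-line drawing on a parabola\<close>

definition parabola :: "nat \<Rightarrow> complex" where
  "parabola n = Complex (real n) ((real n)\<^sup>2)"

lemma inj_parabola: "inj parabola"
  unfolding parabola_def inj_def by auto

text \<open>The left-hand side of the last equation vanishes on the line through the points of the
  parabola with parameters \<open>r\<close> and \<open>s\<close>, and its sign tells the sides of that line apart.\<close>
lemma parabola_chord_form:
  assumes "z \<in> closed_segment (parabola u) (parabola v)"
  obtains t where "0 \<le> t" "t \<le> 1" "z = (1 - t) *\<^sub>R parabola u + t *\<^sub>R parabola v"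
    "\<And>r s. Im z - (r + s) * Re z + r * s =
       (1 - t) * ((real u - r) * (real u - s)) + t * ((real v - r) * (real v - s))"
proof -
  obtain t where t: "0 \<le> t" "t \<le> 1" "z = (1 - t) *\<^sub>R parabola u + t *\<^sub>R parabola v"
    using assms unfolding closed_segment_def by blast
  have "Re z = (1 - t) * real u + t * real v" "Im z = (1 - t) * (real u)\<^sup>2 + t * (real v)\<^sup>2"
    using t(3) by (simp_all add: parabola_def)
  then have "Im z - (r + s) * Re z + r * s =
       (1 - t) * ((real u - r) * (real u - s)) + t * ((real v - r) * (real v - s))" for r s
    by (simp only:) (simp add: algebra_simps power2_eq_square)
  with t that show thesis by blast
qed

lemma parabola_mem_chord:
  assumes "parabola w \<in> closed_segment (parabola u) (parabola v)"
  shows "w = u \<or> w = v"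
proof -
  obtain t where t: "\<And>r s. Im (parabola w) - (r + s) * Re (parabola w) + r * s =
       (1 - t) * ((real u - r) * (real u - s)) + t * ((real v - r) * (real v - s))"
    using parabola_chord_form[OF assms] by blast
  \<comment> \<open>With \<open>r\<close> and \<open>s\<close> the parameters of the chord's own
    ends, the right-hand side vanishes.\<close>
  have "(real w - real u) * (real w - real v) = 0"
    using t[of "real u" "real v"] by (simp add: parabola_def algebra_simps power2_eq_square)
  then show ?thesis by simp
qed

lemma parabola_chords_disjoint:
  assumes "x < y" "u < v" "(x, y) \<noteq> (u, v)" "\<not> (x < u \<and> u < y \<and> y < v)" "\<not> (u < x \<and> x < v \<and> v < y)"
    and z: "z \<in> closed_segment (parabola x) (parabola y)" "z \<in> closed_segment (parabola u) (parabola v)"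
  shows "z \<in> parabola ` ({x, y} \<inter> {u, v})"
proof -
  obtain s where s: "\<And>r q. Im z - (r + q) * Re z + r * q =
       (1 - s) * ((real x - r) * (real x - q)) + s * ((real y - r) * (real y - q))"
    using parabola_chord_form[OF z(1)] by blast
  obtain t where t: "0 \<le> t" "t \<le> 1" "z = (1 - t) *\<^sub>R parabola u + t *\<^sub>R parabola v"
    "\<And>r q. Im z - (r + q) * Re z + r * q =
       (1 - t) * ((real u - r) * (real u - q)) + t * ((real v - r) * (real v - q))"
    using parabola_chord_form[OF z(2)] by blast
  \<comment> \<open>These are the values of the linear form of the line \<open>xy\<close> at the
    ends of the chord \<open>uv\<close>; the form vanishes at \<open>z\<close>.\<close>
  define fu where "fu = (real u - real x) * (real u - real y)"
  define fv where "fv = (real v - real x) * (real v - real y)"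
  have sum0: "(1 - t) * fu + t * fv = 0"
    using s[of "real x" "real y"] t(4)[of "real x" "real y"] unfolding fu_def fv_def by simp
  \<comment> \<open>Ends that do not interleave put \<open>u\<close> and \<open>v\<close> weakly on
    the same side of the line \<open>xy\<close>, so both terms of \<open>sum0\<close> must
    vanish.\<close>
  have "(0 \<le> fu \<and> 0 \<le> fv) \<or> (fu \<le> 0 \<and> fv \<le> 0)"
  proof -
    have nonneg: "0 \<le> (real w - real x) * (real w - real y)" if "w \<le> x \<or> y \<le> w" for w
      using that \<open>x < y\<close> by (auto simp: zero_le_mult_iff)
    have nonpos: "(real w - real x) * (real w - real y) \<le> 0" if "x \<le> w" "w \<le> y" for w
      using that by (simp add: mult_nonneg_nonpos)
    have "(u \<le> x \<or> y \<le> u) \<and> (v \<le> x \<or> y \<le> v) \<or> x \<le> u \<and> u \<le> y \<and> x \<le> v \<and> v \<le> y"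
      using assms(1,2,4,5) by linarith
    then show ?thesis using nonneg nonpos unfolding fu_def fv_def by blast
  qed
  then have 0: "(1 - t) * fu = 0" "t * fv = 0"
    using sum0 t(1,2) by (smt (verit) mult_nonneg_nonneg mult_nonneg_nonpos)+
  have fu0: "fu = 0 \<longleftrightarrow> u = x \<or> u = y" and fv0: "fv = 0 \<longleftrightarrow> v = x \<or> v = y"
    unfolding fu_def fv_def by auto
  \<comment> \<open>Either \<open>z\<close> is an end of \<open>uv\<close> that is also an end of
    \<open>xy\<close>, or both ends agree and the chords coincide, which is excluded.\<close>
  consider "t = 0" | "t = 1" | "fu = 0" "fv = 0" using 0 by auto
  then show ?thesis
  proof cases
    case 1
    then show ?thesis using t(3) 0 fu0 by auto
  next
    case 2
    then show ?thesis using t(3) 0 fv0 by auto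
  next
    case 3
    then show ?thesis using fu0 fv0 assms(1-3) by auto
  qed
qed

text \<open>This keeps the convex hull of the vertex points on or above the parabola, so that every
  vertex can be reached from below.\<close>

lemma convex_epigraph_square: "convex {z::complex. (Re z)\<^sup>2 \<le> Im z}"
proof -
  have "convex_on UNIV (\<lambda>x::real. x\<^sup>2)" by (rule convex_power2)
  then have "convex (epigraph UNIV (\<lambda>x::real. x\<^sup>2))" by (simp add: convex_epigraph)
  moreover have "{z::complex. (Re z)\<^sup>2 \<le> Im z} = (\<lambda>z. (Re z, Im z)) -` epigraph UNIV (\<lambda>x. x\<^sup>2)"
    unfolding epigraph_def by auto
  moreover have "linear (\<lambda>z. (Re z, Im z))" by (auto intro!: linearI)
  ultimately show ?thesis by (simp add: convex_linear_vimage)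
qed

lemma outerplanar_if_noncrossing:
  fixes p :: "'a \<Rightarrow> nat"
  assumes sg: "simple_graph V E" and inj: "inj_on p V" and nc: "noncrossing p E"
  shows "outerplanar V E"
proof -
  define pos where "pos v = parabola (p v)" for v
  have fin: "finite V" using sg unfolding simple_graph_def by blast
  have posinj: "inj_on pos V"
    unfolding pos_def using inj inj_parabola by (auto simp: inj_on_def)
  have "\<forall>e\<in>E. \<exists>u v. e = {u, v} \<and> u \<in> V \<and> v \<in> V \<and> p u < p v"
    using sg inj unfolding simple_graph_def by (metis inj_onD insert_commute linorder_neqE_nat)
  then obtain s t where st: "\<And>e. e \<in> E \<Longrightarrow> e = {s e, t e} \<and> s e \<in> V \<and> t e \<in> V \<and> p (s e) < p (t e)"
    by metis
  define \<gamma> where "\<gamma> e = linepath (pos (s e)) (pos (t e))" for e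
  have emb: "plane_embedding V E pos \<gamma>"
    unfolding plane_embedding_def
  proof (intro conjI ballI impI)
    fix e assume e: "e \<in> E"
    have "pos (s e) \<noteq> pos (t e)" using st[OF e] inj_parabola unfolding pos_def by (metis injD nat_neq_iff)
    then show "arc (\<gamma> e)" unfolding \<gamma>_def by (rule arc_linepath)
    show "\<exists>u v. e = {u, v} \<and> pathstart (\<gamma> e) = pos u \<and> pathfinish (\<gamma> e) = pos v"
      unfolding \<gamma>_def using st[OF e] by auto
    show "path_image (\<gamma> e) \<inter> pos ` V = pos ` e"
    proof
      have "pos ` e = {pos (s e), pos (t e)}" using st[OF e] by (metis image_empty image_insert)
      then show "pos ` e \<subseteq> path_image (\<gamma> e) \<inter> pos ` V"
        using st[OF e] unfolding \<gamma>_def by simp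
      show "path_image (\<gamma> e) \<inter> pos ` V \<subseteq> pos ` e"
      proof
        fix z assume "z \<in> path_image (\<gamma> e) \<inter> pos ` V"
        then obtain w where w: "w \<in> V" "z = pos w" "pos w \<in> closed_segment (pos (s e)) (pos (t e))"
          unfolding \<gamma>_def by auto
        then have "p w = p (s e) \<or> p w = p (t e)" unfolding pos_def by (metis parabola_mem_chord)
        then have "w = s e \<or> w = t e" using inj w st[OF e] by (meson inj_onD)
        then show "z \<in> pos ` e" using w st[OF e] by auto
      qed
    qed
  next
    fix e e' assume e: "e \<in> E" "e' \<in> E" "e \<noteq> e'"
    show "path_image (\<gamma> e) \<inter> path_image (\<gamma> e') \<subseteq> pos ` (e \<inter> e')"
    proof
      fix z assume z: "z \<in> path_image (\<gamma> e) \<inter> path_image (\<gamma> e')"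
      note a = st[OF e(1)] and b = st[OF e(2)]
      have ne: "(p (s e), p (t e)) \<noteq> (p (s e'), p (t e'))"
        using a b e(3) inj by (metis inj_onD prod.inject)
      have E: "{s e, t e} \<in> E" "{s e', t e'} \<in> E" using a b e by auto
      have "z \<in> parabola ` ({p (s e), p (t e)} \<inter> {p (s e'), p (t e')})"
      proof (rule parabola_chords_disjoint)
        show "\<not> (p (s e) < p (s e') \<and> p (s e') < p (t e) \<and> p (t e) < p (t e'))"
          using nc E unfolding noncrossing_def by blast
        show "\<not> (p (s e') < p (s e) \<and> p (s e) < p (t e') \<and> p (t e') < p (t e))"
          using nc E unfolding noncrossing_def by blast
      qed (use a b ne z in \<open>auto simp: \<gamma>_def pos_def\<close>)
      also have "{p (s e), p (t e)} \<inter> {p (s e'), p (t e')} = p ` e \<inter> p ` e'"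
        using a b by (metis image_empty image_insert)
      also have "\<dots> = p ` (e \<inter> e')"
        using inj_on_image_Int[OF inj, of e e'] a b by (metis empty_subsetI insert_subset)
      finally show "z \<in> pos ` (e \<inter> e')" unfolding pos_def by auto
    qed
  qed (rule posinj)
  define K where "K = convex hull (pos ` V)"
  have K: "convex K" "bounded K"
    unfolding K_def using fin by (simp_all add: bounded_convex_hull finite_imp_bounded)
  have DK: "drawing V E pos \<gamma> \<subseteq> K"
  proof -
    have "pos ` V \<subseteq> K" unfolding K_def by (rule hull_subset)
    moreover have "path_image (\<gamma> e) \<subseteq> K" if "e \<in> E" for e
      using st[OF that] calculation K(1) unfolding \<gamma>_def by (simp add: closed_segment_subset image_subset_iff)
    ultimately show ?thesis unfolding drawing_def by blast
  qed
  have Kepi: "K \<subseteq> {z. (Re z)\<^sup>2 \<le> Im z}"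
    unfolding K_def by (rule hull_minimal) (auto simp: pos_def parabola_def convex_epigraph_square)
  \<comment> \<open>In the plane the complement of a bounded convex set is connected, so it lies in
    a single face, which is unbounded.\<close>
  have "connected (- K)"
    using K by (intro connected_complement_bounded_convex) auto
  moreover have unb: "\<not> bounded (- K)" using K(2) cobounded_imp_unbounded by fastforce
  ultimately obtain F where F: "F \<in> components (- drawing V E pos \<gamma>)" "- K \<subseteq> F"
    using exists_component_superset[of "- K" "- drawing V E pos \<gamma>"] DK
    by (metis Compl_anti_mono bounded_empty compl_le_compl_iff subset_empty)
  have "\<not> bounded F" using unb F(2) bounded_subset by blast
  moreover have "pos v \<in> closure F" for v
  proof -
    \<comment> \<open>Points vertically below \<open>pos v\<close> lie under the parabola, hence
      outside \<open>K\<close> and in \<open>F\<close>, and they converge to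
      \<open>pos v\<close>.\<close>
    have "pos v - Complex 0 (inverse (real (Suc n))) \<in> F" for n
    proof -
      have "pos v - Complex 0 (inverse (real (Suc n))) \<notin> {z. (Re z)\<^sup>2 \<le> Im z}"
        by (simp add: pos_def parabola_def)
      then show ?thesis using Kepi F(2) by blast
    qed
    moreover have "(\<lambda>n. pos v - Complex 0 (inverse (real (Suc n)))) \<longlonglongrightarrow> pos v - Complex 0 0"
      by (intro tendsto_intros tendsto_Complex LIMSEQ_inverse_real_of_nat)
    moreover have "pos v - Complex 0 0 = pos v" by (simp add: complex_eq_iff)
    ultimately show ?thesis unfolding closure_sequential by metis
  qed
  ultimately show ?thesis unfolding outerplanar_def using sg emb F(1) by blast
qed

theorem mainTheorem16:
  fixes cs :: "'a list" and \<H> :: "'a set set" and c :: "'a \<Rightarrow> colour"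
  assumes "is_cycle_list cs"
    and "\<forall>H\<in>\<H>. H \<subseteq> set cs"
    and "abab_free cs \<H>"
  shows "\<exists>E. outerplanar {v \<in> set cs. c v = Blue} E \<and>
           (\<forall>H\<in>\<H>. induced_connected E (H \<inter> {v \<in> set cs. c v = Blue}))"
proof -
  define V where "V = {v \<in> set cs. c v = Blue}"
  \<comment> \<open>The index in \<open>cs\<close>: the cycle is cut open before its first list
    entry.\<close>
  define p where "p = inv_into {..<length cs} ((!) cs)"
  have surj: "set cs = (!) cs ` {..<length cs}" by (auto simp: set_conv_nth)
  have p: "p v < length cs" "cs ! p v = v" if "v \<in> V" for v
  proof -
    have v: "v \<in> (!) cs ` {..<length cs}" using that surj unfolding V_def by auto
    show "p v < length cs" using inv_into_into[OF v] unfolding p_def by simp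
    show "cs ! p v = v" using f_inv_into_f[OF v] unfolding p_def .
  qed
  have inj: "inj_on p V" by (rule inj_onI) (metis p(2))
  \<comment> \<open>Four blue vertices at increasing positions are in cyclic order on the whole
    cycle, so an alternation within \<open>V\<close> is an \<open>abab_pair\<close>.\<close>
  have "alternation_free p V \<H>"
    unfolding alternation_free_def
  proof (intro ballI impI)
    fix H H' a b d e
    assume *: "H \<in> \<H>" "H' \<in> \<H>" "a \<in> V" "b \<in> V" "d \<in> V" "e \<in> V"
      "p a < p b" "p b < p d" "p d < p e" "a \<in> H - H'" "b \<in> H' - H" "d \<in> H - H'" "e \<in> H' - H"
    then have "in_cyclic_order cs a b d e" unfolding in_cyclic_order_def using p by metis
    then have "abab_pair cs H H'" unfolding abab_pair_def using * by blast
    then show False using assms(3) * unfolding abab_free_def by blast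
  qed
  moreover have "finite V" unfolding V_def by simp
  ultimately obtain E where "simple_graph V E" "noncrossing p E" "\<forall>H\<in>\<H>. induced_connected E (H \<inter> V)"
    using noncrossing_support inj by blast
  then show ?thesis using outerplanar_if_noncrossing[OF _ inj] unfolding V_def by blast
qed

end
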